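(* Let $G=(V,E)$ be a weakly connected directed graph with $n$ vertices and $m$ edges, and let $\alpha$ be a constant such that every subgraph $G'$ of $G$ satisfies $\delta(G')\le\alpha\,\delta(G)$. Then there exists a spanning tree $T$ of $G$ such that \[ H(G-T)\le H(G)-\frac{n}{2\alpha}\,\mathcal{H}(G)+\frac{2n}{\ln 2}. \]
   Context: For a graph $G'$ with $n'$ vertices and $m'$ edges, its density is $\delta(G')=m'/n'$. A spanning tree of a directed graph is a set of edges forming a spanning tree of the underlying undirected graph (orientations ignored); $G-T$ denotes $G$ with the edges of $T$ removed. With $d_v$ the indegree of $v$ and $m$ the number of edges, $H(G)=\sum_v d_v\lg(m/d_v)$ and $\mathcal{H}(G)=\sum_v \frac{d_v}{m}\lg\frac{m}{d_v}=H(G)/m$ (per-edge indegree entropy), with $0\lg(\cdot/0)=0$, $\lg=\log_2$. *)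

theory Defs
  imports Complex_Main "Graph_Theory.Digraph_Component"
begin

definition density :: "('a, 'b) pre_digraph \<Rightarrow> real" where
  "density G = real (card (arcs G)) / real (card (verts G))"

text \<open>
  In both entropies, a vertex of indegree 0 contributes 0 because the factor \<^term>\<open>in_degree G v\<close>
  vanishes. The per-edge entropy of a graph without arcs is 0, by the convention x / 0 = 0.
\<close>

definition indegree_entropy :: "('a, 'b) pre_digraph \<Rightarrow> real" where
  "indegree_entropy G =
     (\<Sum>v\<in>verts G. real (in_degree G v) * log 2 (real (card (arcs G)) / real (in_degree G v)))"

definition indegree_entropy_per_edge :: "('a, 'b) pre_digraph \<Rightarrow> real" where
  "indegree_entropy_per_edge G =
     (\<Sum>v\<in>verts G. real (in_degree G v) / real (card (arcs G)) *
        log 2 (real (card (arcs G)) / real (in_degree G v)))"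

definition remove_arcs :: "('a, 'b) pre_digraph \<Rightarrow> 'b set \<Rightarrow> ('a, 'b) pre_digraph" where
  "remove_arcs G T = G\<lparr>arcs := arcs G - T\<rparr>"

text \<open>
  The library predicates \<^const>\<open>forest\<close> and \<^const>\<open>spanning_tree\<close> only exclude
  directed cycles (an acyclically oriented triangle is a \<^const>\<open>tree\<close>), so they do not describe
  trees of the underlying undirected graph. Undirected cycles are expressed instead as cycles of the
  digraph in which every arc may be traversed in both directions (the flag is the direction), with
  no arc used twice. A pair of antiparallel arcs is thus an undirected cycle, so a spanning tree
  contains at most one of the two.
\<close>

definition both_directions :: "('a, 'b) pre_digraph \<Rightarrow> ('a, 'b \<times> bool) pre_digraph" where
  "both_directions G =
     \<lparr>verts = verts G, arcs = arcs G \<times> UNIV,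
      tail = (\<lambda>(e, fwd). if fwd then tail G e else head G e),
      head = (\<lambda>(e, fwd). if fwd then head G e else tail G e)\<rparr>"

definition undirected_cycle :: "('a, 'b) pre_digraph \<Rightarrow> ('b \<times> bool) list \<Rightarrow> bool" where
  "undirected_cycle G p \<longleftrightarrow> pre_digraph.cycle (both_directions G) p \<and> distinct (map fst p)"

text \<open>
  \<^const>\<open>Digraph_Component.connected\<close> is weak connectivity of a nonempty digraph.
\<close>

definition undirected_spanning_tree :: "('a, 'b) pre_digraph \<Rightarrow> 'b set \<Rightarrow> bool" where
  "undirected_spanning_tree G T \<longleftrightarrow>
     spanning (G\<lparr>arcs := T\<rparr>) G \<and>
     Digraph_Component.connected (G\<lparr>arcs := T\<rparr>) \<and>
     (\<nexists>p. undirected_cycle (G\<lparr>arcs := T\<rparr>) p)"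

end

theory Submission
  imports Defs
begin

text \<open>
  Give the arc \<open>e\<close> the weight \<open>lg (m / d)\<close>, where \<open>d\<close> is the indegree of its head, so that \<open>H(G)\<close> is
  the total weight. By Gibbs' inequality, removing \<open>T\<close> lowers the entropy by at least the weight of
  \<open>T\<close>, so a spanning tree of weight at least \<open>c\<close> times the total weight, with \<open>c = n / (2 \<alpha> m)\<close>,
  suffices. By the density hypothesis, the rank of every set \<open>B\<close> of arcs (the size of a maximal
  forest in it) is at least \<open>c |B|\<close>. A maximum-weight spanning tree meets every set of heavier arcs
  in a maximal forest, hence in at least a fraction \<open>c\<close> of them, and so it carries at least a
  fraction \<open>c\<close> of the total weight.
\<close>

section \<open>Undirected reachability\<close>

text \<open>Shaped to match \<open>connected_conv\<close>: a nonempty spanning subgraph with arcs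
  \<open>A\<close> is connected iff this relation holds between any two vertices.\<close>

definition undirected_reach :: "('a, 'b) pre_digraph \<Rightarrow> 'b set \<Rightarrow> ('a \<times> 'a) set" where
  "undirected_reach G A = rtrancl_on (verts G) (symcl (arcs_ends (G\<lparr>arcs := A\<rparr>)))"

lemma undirected_reach_mono:
  "A \<subseteq> B \<Longrightarrow> (x, y) \<in> undirected_reach G A \<Longrightarrow> (x, y) \<in> undirected_reach G B"
  unfolding undirected_reach_def
  by (erule rtrancl_on_mono[rotated 2]) (auto simp: symcl_def arcs_ends_conv image_image)

lemma undirected_reach_sym:
  assumes "(x, y) \<in> undirected_reach G A"
  shows "(y, x) \<in> undirected_reach G A"
proof -
  have "sym (symcl (arcs_ends (G\<lparr>arcs := A\<rparr>)))"
    by (auto simp: symcl_def sym_def)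
  from rtrancl_on_sym[OF this] show ?thesis
    using assms unfolding undirected_reach_def by (rule symE)
qed

lemma undirected_reach_trans:
  "(x, y) \<in> undirected_reach G A \<Longrightarrow> (y, z) \<in> undirected_reach G A \<Longrightarrow>
   (x, z) \<in> undirected_reach G A"
  unfolding undirected_reach_def by (rule rtrancl_on_trans)

lemma (in wf_digraph) undirected_reach_arc:
  assumes "e \<in> A" "e \<in> arcs G"
  shows "(tail G e, head G e) \<in> undirected_reach G A"
  unfolding undirected_reach_def using assms
  by (intro rtrancl_on_into_rtrancl_on[OF rtrancl_on_refl])
     (auto simp: symcl_def arcs_ends_conv)

text \<open>A label on which the ends of each arc agree cannot change along a path. In a connected
  graph this leaves a single label.\<close>

lemma undirected_reach_constant:
  assumes "(x, y) \<in> undirected_reach G A" "\<And>e. e \<in> A \<Longrightarrow> r (tail G e) = r (head G e)"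
  shows "r x = r y"
  using assms(1) unfolding undirected_reach_def
  by (induction rule: rtrancl_on_induct) (auto simp: symcl_def arcs_ends_conv assms(2))

section \<open>Undirected cycles\<close>

lemma both_directions_simps [simp]:
  "verts (both_directions G) = verts G"
  "arcs (both_directions G) = arcs G \<times> UNIV"
  "tail (both_directions G) (e, b) = (if b then tail G e else head G e)"
  "head (both_directions G) (e, b) = (if b then head G e else tail G e)"
  by (simp_all add: both_directions_def)

lemma both_directions_walk_constant:
  assumes "pre_digraph.cas (both_directions G) u p v"
    and "\<And>e. e \<in> fst ` set p \<Longrightarrow> r (tail G e) = r (head G e)"
  shows "r u = r v"
  using assms
proof (induction p arbitrary: u)
  case Nil
  then show ?case by (simp add: pre_digraph.cas.simps)
next
  case (Cons a p)
  obtain e b where a: "a = (e, b)" by (cases a)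
  with Cons.prems(1) have u: "u = tail (both_directions G) (e, b)"
    and cas: "pre_digraph.cas (both_directions G) (head (both_directions G) (e, b)) p v"
    by (auto simp: pre_digraph.cas.simps)
  have "r (head (both_directions G) (e, b)) = r v"
    using Cons.IH[OF cas] Cons.prems(2) by simp
  moreover have "r (tail G e) = r (head G e)"
    using Cons.prems(2)[of e] a by simp
  ultimately show ?case using u by (auto split: if_splits)
qed

text \<open>\<open>cas\<close> and \<open>awalk_verts\<close> depend only on tails and heads, so
  cycles for different arc sets can be compared as walks in one fixed digraph; \<open>A\<close>
  matters only through containment.\<close>

lemma undirected_cycle_arcs_update:
  "undirected_cycle (G\<lparr>arcs := A\<rparr>) p \<longleftrightarrow>
     (\<exists>u. u \<in> verts G \<and> fst ` set p \<subseteq> A \<and> pre_digraph.cas (both_directions G) u p u \<and>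
       distinct (tl (pre_digraph.awalk_verts (both_directions G) u p))) \<and>
     p \<noteq> [] \<and> distinct (map fst p)"
proof -
  have "compatible (both_directions (G\<lparr>arcs := A\<rparr>)) (both_directions G)"
    by (simp add: compatible_def both_directions_def fun_eq_iff)
  note eqs = compatible_cas[OF this] compatible_awalk_verts[OF this]
  have "set p \<subseteq> A \<times> UNIV \<longleftrightarrow> fst ` set p \<subseteq> A" by auto
  then show ?thesis
    by (auto simp: undirected_cycle_def pre_digraph.cycle_def pre_digraph.awalk_def eqs)
qed

text \<open>
  An undirected cycle uses the new arc at most once, so the rest of the cycle is a walk of old arcs
  between the ends of the new one.
\<close>

lemma no_undirected_cycle_insert:
  assumes acyc: "\<nexists>p. undirected_cycle (G\<lparr>arcs := F\<rparr>) p"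
    and const: "\<And>a. a \<in> F \<Longrightarrow> r (tail G a) = r (head G a)"
    and new: "r (tail G e) \<noteq> r (head G e)"
  shows "\<nexists>p. undirected_cycle (G\<lparr>arcs := insert e F\<rparr>) p"
proof
  let ?D = "both_directions G"
  assume "\<exists>p. undirected_cycle (G\<lparr>arcs := insert e F\<rparr>) p"
  then obtain p u where u: "u \<in> verts G" and set_p: "fst ` set p \<subseteq> insert e F"
    and cas: "pre_digraph.cas ?D u p u" and dist: "distinct (tl (pre_digraph.awalk_verts ?D u p))"
    and ne: "p \<noteq> []" and dist_p: "distinct (map fst p)"
    unfolding undirected_cycle_arcs_update by blast
  show False
  proof (cases "e \<in> fst ` set p")
    case False
    with set_p have "fst ` set p \<subseteq> F" by blast
    with u cas dist ne dist_p have "undirected_cycle (G\<lparr>arcs := F\<rparr>) p"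
      unfolding undirected_cycle_arcs_update by blast
    with acyc show False by blast
  next
    case True
    then obtain b p1 p2 where p: "p = p1 @ (e, b) # p2"
      by (metis imageE prod.collapse split_list)
    have notin: "e \<notin> fst ` set p1" "e \<notin> fst ` set p2"
      using dist_p p by auto
    with set_p p have sub: "fst ` set p1 \<subseteq> F" "fst ` set p2 \<subseteq> F" by auto
    define x where "x = last (pre_digraph.awalk_verts ?D u p1)"
    have x: "pre_digraph.cas ?D u p1 x" "pre_digraph.cas ?D x ((e, b) # p2) u"
      using cas unfolding p x_def pre_digraph.cas_append_iff by blast+
    then have xe: "x = tail ?D (e, b)" and y: "pre_digraph.cas ?D (head ?D (e, b)) p2 u"
      by (auto simp: pre_digraph.cas.simps)
    have "r u = r x"
      by (rule both_directions_walk_constant[OF x(1)]) (use const sub in blast)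
    moreover have "r (head ?D (e, b)) = r u"
      by (rule both_directions_walk_constant[OF y]) (use const sub in blast)
    ultimately show False using new xe by (auto split: if_splits)
  qed
qed

section \<open>Forests and component labels\<close>

text \<open>
  The labelling \<open>r\<close> names the components of \<open>A\<close>; the forest \<open>F\<close> has the same components. The last
  conjunct is the rank formula, written without truncated subtraction.
\<close>

definition component_forest ::
    "('a, 'b) pre_digraph \<Rightarrow> 'b set \<Rightarrow> 'b set \<Rightarrow> ('a \<Rightarrow> 'a) \<Rightarrow> bool" where
  "component_forest G A F r \<longleftrightarrow>
     F \<subseteq> A \<and> (\<nexists>p. undirected_cycle (G\<lparr>arcs := F\<rparr>) p) \<and>
     (\<forall>e\<in>A. r (tail G e) = r (head G e)) \<and>
     (\<forall>x\<in>verts G. \<forall>y\<in>verts G. r x = r y \<longrightarrow> (x, y) \<in> undirected_reach G F) \<and>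
     card F + card (r ` verts G) = card (verts G)"

lemma component_forest_empty: "component_forest G {} {} id"
  by (auto simp: component_forest_def undirected_reach_def undirected_cycle_def
      pre_digraph.cycle_def pre_digraph.awalk_def)

text \<open>One Kruskal step. If the ends of \<open>e\<close> share a label, the forest already
  connects them and stays. Otherwise \<open>e\<close> joins the forest and merges two labels, so one
  more arc is paid for by one label fewer.\<close>

lemma (in fin_digraph) component_forest_insert:
  assumes cf: "component_forest G A F r" and A: "A \<subseteq> arcs G" and e: "e \<in> arcs G" "e \<notin> A"
  shows "\<exists>F' r'. component_forest G (insert e A) F' r' \<and> (F' = F \<or> F' = insert e F)"
proof (cases "r (tail G e) = r (head G e)")
  case True
  with cf have "component_forest G (insert e A) F r"
    by (auto simp: component_forest_def)
  then show ?thesis by blast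
next
  case False
  let ?u = "tail G e" and ?v = "head G e" and ?F = "insert e F"
  define r' where "r' x = (if r x = r ?u then r ?v else r x)" for x
  have FA: "F \<subseteq> A" and const: "\<And>a. a \<in> A \<Longrightarrow> r (tail G a) = r (head G a)"
    and reach: "\<And>x y. x \<in> verts G \<Longrightarrow> y \<in> verts G \<Longrightarrow> r x = r y \<Longrightarrow> (x, y) \<in> undirected_reach G F"
    and card: "card F + card (r ` verts G) = card (verts G)"
    and acyc: "\<nexists>p. undirected_cycle (G\<lparr>arcs := F\<rparr>) p"
    using cf unfolding component_forest_def by blast+
  have uv: "?u \<in> verts G" "?v \<in> verts G" using e by auto
  have finF: "finite F" using FA A finite_subset finite_arcs by metis
  \<comment> \<open>Exactly the label of the tail disappears; the label it is replaced by was
    already in use.\<close>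
  have image: "r' ` verts G = r ` verts G - {r ?u}"
    using False uv by (auto simp: r'_def)
  have "card (r' ` verts G) + 1 = card (r ` verts G)"
    unfolding image using uv card_Suc_Diff1[of "r ` verts G" "r ?u"] by simp
  moreover have "card ?F = card F + 1" using finF e FA by (subst card_insert_disjoint) auto
  ultimately have card': "card ?F + card (r' ` verts G) = card (verts G)" using card by simp
  have reach_uv: "(?u, ?v) \<in> undirected_reach G ?F"
    using e by (intro undirected_reach_arc) auto
  have reach_old: "(x, y) \<in> undirected_reach G ?F"
    if "x \<in> verts G" "y \<in> verts G" "r x = r y" for x y
    using undirected_reach_mono[OF subset_insertI reach[OF that]] .
  have reach': "(x, y) \<in> undirected_reach G ?F"
    if xy: "x \<in> verts G" "y \<in> verts G" "r' x = r' y" for x y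
  proof -
    \<comment> \<open>Labels that became equal only now lie on opposite sides of \<open>e\<close>,
      so the path crosses it, forwards or backwards.\<close>
    consider "r x = r y" | "r x = r ?u" "r y = r ?v" | "r x = r ?v" "r y = r ?u"
      using xy(3) by (auto simp: r'_def split: if_splits)
    then show ?thesis
    proof cases
      case 1
      then show ?thesis using reach_old xy by blast
    next
      case 2
      then have "(x, ?u) \<in> undirected_reach G ?F" "(?v, y) \<in> undirected_reach G ?F"
        using reach_old xy uv by auto
      then show ?thesis using reach_uv undirected_reach_trans by metis
    next
      case 3
      then have "(x, ?v) \<in> undirected_reach G ?F" "(?u, y) \<in> undirected_reach G ?F"
        using reach_old xy uv by auto
      then show ?thesis using undirected_reach_sym[OF reach_uv] undirected_reach_trans by metis
    qed
  qed
  have "\<nexists>p. undirected_cycle (G\<lparr>arcs := ?F\<rparr>) p"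
    using no_undirected_cycle_insert[OF acyc, of r e] const FA False by blast
  moreover have "\<forall>a\<in>insert e A. r' (tail G a) = r' (head G a)"
    using const by (auto simp: r'_def)
  ultimately have "component_forest G (insert e A) ?F r'"
    unfolding component_forest_def using FA reach' card' by blast
  then show ?thesis by blast
qed

section \<open>Maximum-weight forests\<close>

text \<open>
  Kruskal's algorithm. The inequality for an arbitrary lower bound \<open>W\<close> on the weights is
  summation by parts over the arcs in decreasing order of weight.
\<close>

lemma (in fin_digraph) heavy_component_forest:
  fixes w :: "'b \<Rightarrow> real" and c :: real
  assumes rank: "\<And>B F r. B \<subseteq> arcs G \<Longrightarrow> component_forest G B F r \<Longrightarrow> c * card B \<le> card F"
    and "A \<subseteq> arcs G"
  shows "\<exists>F r. component_forest G A F r \<and>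
    (\<forall>W. (\<forall>e\<in>A. W \<le> w e) \<longrightarrow> W * (card F - c * card A) \<le> sum w F - c * sum w A)"
proof -
  have "finite A" using assms(2) finite_arcs finite_subset by blast
  then show ?thesis using assms(2)
  proof (induction A rule: finite_psubset_induct)
    case (psubset A)
    show ?case
    proof (cases "A = {}")
      case True
      have "component_forest G A {} id" using True component_forest_empty by simp
      then show ?thesis using True by (intro exI[of _ "{}"] exI[of _ id]) (simp del: id_apply)
    next
      case False
      \<comment> \<open>Kruskal's algorithm adds a lightest arc last, so \<open>w e\<close> is an
        admissible \<open>W\<close> for the remaining arcs.\<close>
      obtain e where e: "e \<in> A" and min: "\<And>a. a \<in> A \<Longrightarrow> w e \<le> w a"
        using ex_min_if_finite[of "w ` A"] psubset.hyps False
        by (metis (no_types, lifting) arg_min_if_finite(1) arg_min_least)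
      define A' where "A' = A - {e}"
      have A: "A = insert e A'" "e \<notin> A'" "A' \<subset> A" "finite A'" "A' \<subseteq> arcs G" "e \<in> arcs G"
        using e psubset by (auto simp: A'_def)
      obtain F r where cf: "component_forest G A' F r"
        and ineq: "\<And>W. \<forall>a\<in>A'. W \<le> w a \<Longrightarrow> W * (card F - c * card A') \<le> sum w F - c * sum w A'"
        using psubset.IH[OF A(3) A(5)] by blast
      obtain F' r' where cf': "component_forest G A F' r'" and F': "F' = F \<or> F' = insert e F"
        using component_forest_insert[OF cf] A by metis
      have FA: "F \<subseteq> A'" using cf by (simp add: component_forest_def)
      then have F: "finite F" "e \<notin> F" using A finite_subset by auto
      have "w e * (card F - c * card A') \<le> sum w F - c * sum w A'"
        using ineq min A by blast
      moreover have "sum w A = w e + sum w A'" "card A = card A' + 1"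
        using A by auto
      moreover have "card F' - real (card F) = 0 \<and> sum w F' = sum w F \<or>
          card F' - real (card F) = 1 \<and> sum w F' = w e + sum w F"
        using F' F by auto
      \<comment> \<open>For \<open>W = w e\<close>, passing from \<open>A'\<close> to
        \<open>A\<close> changes both sides by the same amount, whether or not \<open>e\<close>
        enters the forest.\<close>
      ultimately have key: "w e * (card F' - c * card A) \<le> sum w F' - c * sum w A"
        by (auto simp: algebra_simps)
      \<comment> \<open>By the rank bound the factor of \<open>W\<close> is nonnegative, so lowering
        \<open>w e\<close> to \<open>W\<close> can only decrease the left side.\<close>
      have "c * card A \<le> card F'" using rank[OF _ cf'] psubset.prems by blast
      then have "W * (card F' - c * card A) \<le> sum w F' - c * sum w A"
        if "\<forall>a\<in>A. W \<le> w a" for W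
        using key mult_right_mono[of W "w e" "card F' - c * card A"] that e by fastforce
      with cf' show ?thesis by blast
    qed
  qed
qed

text \<open>As the weights are nonnegative, \<open>W = 0\<close> is admissible and leaves just the
  weight bound. Connectedness forces a single label, so the forest spans.\<close>

lemma (in fin_digraph) heavy_spanning_tree:
  fixes w :: "'b \<Rightarrow> real" and c :: real
  assumes "Digraph_Component.connected G"
    and rank: "\<And>B F r. B \<subseteq> arcs G \<Longrightarrow> component_forest G B F r \<Longrightarrow> c * card B \<le> card F"
    and nonneg: "\<And>e. e \<in> arcs G \<Longrightarrow> 0 \<le> w e"
  shows "\<exists>T\<subseteq>arcs G. undirected_spanning_tree G T \<and> c * sum w (arcs G) \<le> sum w T"
proof -
  obtain F r where cf: "component_forest G (arcs G) F r"
    and "\<forall>W. (\<forall>e\<in>arcs G. W \<le> w e) \<longrightarrow>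
      W * (card F - c * card (arcs G)) \<le> sum w F - c * sum w (arcs G)"
    using heavy_component_forest[of c "arcs G" w] rank by blast
  from this(2)[rule_format, of 0] have weight: "c * sum w (arcs G) \<le> sum w F"
    using nonneg by simp
  have F: "F \<subseteq> arcs G" and const: "\<And>e. e \<in> arcs G \<Longrightarrow> r (tail G e) = r (head G e)"
    and reach: "\<And>x y. x \<in> verts G \<Longrightarrow> y \<in> verts G \<Longrightarrow> r x = r y \<Longrightarrow> (x, y) \<in> undirected_reach G F"
    and acyc: "\<nexists>p. undirected_cycle (G\<lparr>arcs := F\<rparr>) p"
    using cf unfolding component_forest_def by blast+
  have conn: "verts G \<noteq> {}"
      "\<And>x y. x \<in> verts G \<Longrightarrow> y \<in> verts G \<Longrightarrow> (x, y) \<in> undirected_reach G (arcs G)"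
    using assms(1) by (auto simp: connected_conv undirected_reach_def)
  have "(x, y) \<in> undirected_reach G F" if "x \<in> verts G" "y \<in> verts G" for x y
    by (rule reach[OF that undirected_reach_constant[OF conn(2)[OF that] const]])
  with conn(1) have "Digraph_Component.connected (G\<lparr>arcs := F\<rparr>)"
    by (auto simp: connected_conv undirected_reach_def)
  moreover have "spanning (G\<lparr>arcs := F\<rparr>) G"
    using F by (auto simp: spanning_def subgraph_def compatible_def wf_digraph_axioms
        intro!: wf_digraph.intro)
  ultimately show ?thesis
    using F acyc weight unfolding undirected_spanning_tree_def by blast
qed

section \<open>From density to rank\<close>

text \<open>
  A component with \<open>k \<ge> 2\<close> vertices has at most \<open>D * k \<le> 2 * D * (k - 1)\<close> arcs, and a component
  with a single vertex has none.
\<close>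

lemma (in digraph) component_forest_rank:
  fixes D :: real
  assumes dens: "\<And>G'. subgraph G' G \<Longrightarrow> verts G' \<noteq> {} \<Longrightarrow> density G' \<le> D"
    and "0 \<le> D" and B: "B \<subseteq> arcs G" and cf: "component_forest G B F r"
  shows "card B \<le> 2 * D * card F"
proof -
  define C where "C c = {x \<in> verts G. r x = c}" for c
  define E where "E c = {e \<in> B. r (head G e) = c}" for c
  have const: "\<And>e. e \<in> B \<Longrightarrow> r (tail G e) = r (head G e)"
    and card: "card F + card (r ` verts G) = card (verts G)"
    using cf unfolding component_forest_def by blast+
  have finB: "finite B" using B finite_arcs by (rule finite_subset)
  have bound: "card (E c) \<le> 2 * D * (real (card (C c)) - 1)" if c: "c \<in> r ` verts G" for c
  proof -
    \<comment> \<open>One component with the arcs of \<open>B\<close> inside it; it need not be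
      induced, since the density bound covers all subgraphs.\<close>
    let ?H = "\<lparr>verts = C c, arcs = E c, tail = tail G, head = head G\<rparr>"
    have ends: "tail G e \<in> C c \<and> head G e \<in> C c" if "e \<in> E c" for e
      using that B const by (auto simp: C_def E_def)
    have "subgraph ?H G"
      using ends B by (auto simp: subgraph_def compatible_def wf_digraph_axioms C_def E_def
          intro!: wf_digraph.intro)
    moreover have ne: "C c \<noteq> {}" using c by (auto simp: C_def)
    ultimately have "density ?H \<le> D" using dens by simp
    moreover have pos: "card (C c) > 0" using ne by (simp add: C_def card_gt_0_iff)
    ultimately have le: "card (E c) \<le> D * card (C c)"
      by (simp add: density_def divide_le_eq)
    show ?thesis
    proof (cases "card (C c) = 1")
      case True
      then obtain x where "C c = {x}" by (auto simp: card_1_singleton_iff)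
      then have "E c = {}" using ends no_loops B by (fastforce simp: E_def)
      then show ?thesis using True by simp
    next
      case False
      with pos have "2 \<le> card (C c)" by linarith
      then have "real (card (C c)) \<le> 2 * (real (card (C c)) - 1)" by simp
      from mult_left_mono[OF this \<open>0 \<le> D\<close>] le show ?thesis by (simp add: algebra_simps)
    qed
  qed
  have "real (card B) = (\<Sum>c\<in>r ` verts G. real (card (E c)))"
  proof -
    have "(r \<circ> head G) ` B \<subseteq> r ` verts G" using B by auto
    from sum.group[OF finB _ this, of "\<lambda>_. 1::real"] show ?thesis by (simp add: E_def)
  qed
  also have "\<dots> \<le> (\<Sum>c\<in>r ` verts G. 2 * D * (real (card (C c)) - 1))"
    using bound by (intro sum_mono) auto
  also have "\<dots> = 2 * D * ((\<Sum>c\<in>r ` verts G. real (card (C c))) - card (r ` verts G))"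
    by (simp add: sum_distrib_left[symmetric] sum_subtractf)
  also have "(\<Sum>c\<in>r ` verts G. real (card (C c))) = card (verts G)"
    using sum.group[of "verts G" "r ` verts G" r "\<lambda>_. 1::real"] by (simp add: C_def)
  \<comment> \<open>Vertices minus components is the size of the forest, by the rank
    formula.\<close>
  also have "real (card (verts G)) - card (r ` verts G) = card F"
    using card by simp
  finally show ?thesis .
qed

section \<open>Entropy and arc weights\<close>

text \<open>Grouping arcs by head turns arc weights into entropy terms; \<open>f = 1\<close> gives
  that indegrees add up to the number of arcs.\<close>

lemma (in fin_digraph) sum_arcs_by_head:
  fixes f :: "'a \<Rightarrow> real"
  assumes "A \<subseteq> arcs G"
  shows "(\<Sum>e\<in>A. f (head G e)) = (\<Sum>v\<in>verts G. in_degree (G\<lparr>arcs := A\<rparr>) v * f v)"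
proof -
  have "finite A" using assms finite_arcs by (rule finite_subset)
  then have "(\<Sum>e\<in>A. f (head G e)) = (\<Sum>v\<in>verts G. \<Sum>e | e \<in> A \<and> head G e = v. f (head G e))"
    using assms by (intro sum.group[symmetric]) auto
  also have "\<dots> = (\<Sum>v\<in>verts G. in_degree (G\<lparr>arcs := A\<rparr>) v * f v)"
    by (intro sum.cong) (auto simp: in_degree_def in_arcs_def)
  finally show ?thesis .
qed

text \<open>Gibbs' inequality, comparing the indegree distributions of \<open>G - T\<close> and \<open>G\<close>.\<close>

lemma (in fin_digraph) indegree_entropy_remove_arcs_le:
  assumes "T \<subseteq> arcs G"
  shows "indegree_entropy (remove_arcs G T) \<le>
    indegree_entropy G - (\<Sum>e\<in>T. log 2 (card (arcs G) / in_degree G (head G e)))"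
proof -
  let ?A = "arcs G - T"
  define m where "m = real (card (arcs G))"
  define m' where "m' = real (card ?A)"
  define d where "d v = real (in_degree G v)" for v
  define d' where "d' v = real (in_degree (G\<lparr>arcs := ?A\<rparr>) v)" for v
  have sum_d: "(\<Sum>v\<in>verts G. d v) = m"
    using sum_arcs_by_head[of "arcs G" "\<lambda>_. 1"] by (simp add: d_def m_def)
  have sum_d': "(\<Sum>v\<in>verts G. d' v) = m'"
    using sum_arcs_by_head[of ?A "\<lambda>_. 1"] by (simp add: d'_def m'_def)
  have "m' \<le> m" by (auto simp: m_def m'_def intro: card_mono)
  \<comment> \<open>This is \<open>ln x \<le> x - 1\<close> for the ratio \<open>x\<close> of the
    proportions \<open>d v / m\<close> and \<open>d' v / m'\<close>. The last summand is a
    correction that cancels in the sum over all vertices.\<close>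
  have term_le: "d' v * log 2 (m' / d' v) \<le> d' v * log 2 (m / d v) + (m' * d v / m - d' v) / ln 2"
    if v: "v \<in> verts G" for v
  proof (cases "d' v = 0")
    case True
    then show ?thesis by (simp add: m'_def m_def d_def)
  next
    case False
    have d': "0 < d' v" using False by (simp add: d'_def)
    have "d' v \<le> d v"
      unfolding d_def d'_def in_degree_def in_arcs_def by (auto intro!: card_mono)
    moreover have "d' v \<le> m'"
      unfolding sum_d'[symmetric] by (intro member_le_sum v) (auto simp: d'_def)
    ultimately have pos: "0 < d v" "0 < m'" "0 < m" using d' \<open>m' \<le> m\<close> by linarith+
    let ?x = "m' * d v / (d' v * m)"
    have "log 2 (m' / d' v) - log 2 (m / d v) = ln ?x / ln 2"
      using pos d' by (simp add: log_def ln_div ln_mult field_simps)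
    also have "\<dots> \<le> (?x - 1) / ln 2"
      using pos d' by (intro divide_right_mono ln_le_minus_one) auto
    finally have "d' v * (log 2 (m' / d' v) - log 2 (m / d v)) \<le> d' v * ((?x - 1) / ln 2)"
      using d' by (intro mult_left_mono) auto
    also have "\<dots> = (m' * d v / m - d' v) / ln 2"
      using d' pos by (simp add: field_simps)
    finally show ?thesis by (simp add: algebra_simps)
  qed
  have defect: "(\<Sum>v\<in>verts G. (m' * d v / m - d' v) / ln 2) = 0"
  proof -
    have "(\<Sum>v\<in>verts G. m' * d v / m) = m' * m / m"
      by (simp add: sum_distrib_left[symmetric] sum_divide_distrib[symmetric] sum_d)
    \<comment> \<open>If \<open>m = 0\<close> then \<open>m' = 0\<close>, so division by zero gives
      the right value.\<close>
    also have "\<dots> = m'" using \<open>m' \<le> m\<close> by (cases "m = 0") (auto simp: m'_def)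
    finally show ?thesis
      by (simp add: sum_divide_distrib[symmetric] sum_subtractf sum_d')
  qed
  have "indegree_entropy (remove_arcs G T) = (\<Sum>v\<in>verts G. d' v * log 2 (m' / d' v))"
    by (simp add: indegree_entropy_def remove_arcs_def d'_def m'_def)
  also have "\<dots> \<le> (\<Sum>v\<in>verts G. d' v * log 2 (m / d v) + (m' * d v / m - d' v) / ln 2)"
    by (intro sum_mono term_le)
  also have "\<dots> = (\<Sum>v\<in>verts G. d' v * log 2 (m / d v))"
    by (simp only: sum.distrib defect add_0_right)
  \<comment> \<open>The surviving arcs keep the weights they have in \<open>G\<close>, so what is
    lost is the weight of \<open>T\<close>.\<close>
  also have "\<dots> = (\<Sum>e\<in>?A. log 2 (m / d (head G e)))"
    unfolding d'_def by (subst sum_arcs_by_head) auto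
  also have "\<dots> = (\<Sum>e\<in>arcs G. log 2 (m / d (head G e))) - (\<Sum>e\<in>T. log 2 (m / d (head G e)))"
    using assms by (intro sum_diff) auto
  also have "(\<Sum>e\<in>arcs G. log 2 (m / d (head G e))) = indegree_entropy G"
    by (subst sum_arcs_by_head) (simp_all add: indegree_entropy_def d_def m_def)
  finally show ?thesis by (simp add: d_def m_def)
qed

theorem theorem6:
  fixes G :: "('a, 'b) pre_digraph" and \<alpha> :: real
  assumes "digraph G"
    and "Digraph_Component.connected G"
    and "\<And>G'. subgraph G' G \<Longrightarrow> verts G' \<noteq> {} \<Longrightarrow> density G' \<le> \<alpha> * density G"
  shows "\<exists>T. undirected_spanning_tree G T \<and>
    indegree_entropy (remove_arcs G T)
      \<le> indegree_entropy G
         - real (card (verts G)) / (2 * \<alpha>) * indegree_entropy_per_edge G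
         + 2 * real (card (verts G)) / ln 2"
proof -
  interpret digraph G by fact
  let ?n = "real (card (verts G))" and ?m = "real (card (arcs G))"
  let ?w = "\<lambda>e. log 2 (?m / in_degree G (head G e))"
  \<comment> \<open>For \<open>m > 0\<close>, \<open>1 / c\<close> is twice the density bound
    \<open>\<alpha> * density G\<close>, as the rank bound requires; and \<open>c\<close> times the
    entropy is the amount to be subtracted.\<close>
  define c where "c = ?n / (2 * \<alpha> * ?m)"
  have ne: "verts G \<noteq> {}" using assms(2) by (simp add: connected_conv)
  then have n: "?n > 0" by (simp add: card_gt_0_iff)
  have "subgraph G G" by (simp add: subgraph_def compatible_def wf_digraph_axioms)
  from assms(3)[OF this ne] have dens: "density G \<le> \<alpha> * density G" .
  have rank: "c * card B \<le> card F" if B: "B \<subseteq> arcs G" "component_forest G B F r" for B F r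
  proof (cases "?m = 0")
    case True
    then show ?thesis by (simp add: c_def)
  next
    case False
    then have m: "?m > 0" by linarith
    then have "density G > 0" using n by (simp add: density_def)
    \<comment> \<open>Comparing \<open>G\<close> with itself gives \<open>\<alpha> \<ge> 1\<close>,
      which makes the density bound nonnegative and \<open>c\<close> positive.\<close>
    with dens have \<alpha>: "\<alpha> \<ge> 1" by simp
    have "card B \<le> 2 * (\<alpha> * density G) * card F"
      by (rule component_forest_rank[OF assms(3) _ B]) (use \<alpha> in \<open>auto simp: density_def\<close>)
    also have "2 * (\<alpha> * density G) = 1 / c"
      by (simp add: c_def density_def)
    finally show ?thesis
      using n m \<alpha> by (simp add: c_def field_simps)
  qed
  have nonneg: "0 \<le> ?w e" if e: "e \<in> arcs G" for e
  proof -
    have "in_degree G (head G e) \<le> card (arcs G)"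
      unfolding in_degree_def by (intro card_mono) auto
    moreover have "in_degree G (head G e) > 0"
      using e by (auto simp: in_degree_def in_arcs_def card_gt_0_iff)
    ultimately show ?thesis by (simp add: field_simps)
  qed
  have "\<exists>T\<subseteq>arcs G. undirected_spanning_tree G T \<and> c * sum ?w (arcs G) \<le> sum ?w T"
    by (rule heavy_spanning_tree[OF assms(2)]) (fact rank nonneg)+
  then obtain T where T: "T \<subseteq> arcs G"
    "undirected_spanning_tree G T" "c * sum ?w (arcs G) \<le> sum ?w T"
    by auto
  have "sum ?w (arcs G) = indegree_entropy G"
    by (subst sum_arcs_by_head) (simp_all add: indegree_entropy_def)
  moreover have "indegree_entropy_per_edge G = indegree_entropy G / ?m"
    by (simp add: indegree_entropy_per_edge_def indegree_entropy_def sum_divide_distrib)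
  ultimately have "?n / (2 * \<alpha>) * indegree_entropy_per_edge G \<le> sum ?w T"
    using T(3) by (simp add: c_def)
  \<comment> \<open>Adding this nonnegative term only weakens the bound.\<close>
  moreover have "0 \<le> 2 * ?n / ln 2" by simp
  ultimately have "indegree_entropy (remove_arcs G T)
      \<le> indegree_entropy G - ?n / (2 * \<alpha>) * indegree_entropy_per_edge G + 2 * ?n / ln 2"
    using indegree_entropy_remove_arcs_le[OF T(1)] by linarith
  with T(2) show ?thesis by blast
qed

end
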